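(* Let $B^{\mathcal H}_\alpha$ be the Hadamard fractional Brownian motion with parameter $\alpha$, and let $T>0$. (i) If $\alpha\in(0,1)$, the exponent $\alpha$ in the upper bound $\mathbb E|B^{\mathcal H}_\alpha(t)-B^{\mathcal H}_\alpha(s)|^2\le C(t-s)^{\alpha}$, $0\le s\le t\le T$, cannot be replaced by a larger one: for every $\beta>\alpha$ there is no constant $C>0$ such that $\mathbb E|B^{\mathcal H}_\alpha(t)-B^{\mathcal H}_\alpha(s)|^2\le C(t-s)^{\beta}$ for all $0\le s\le t\le T$. (ii) If $\alpha\in(1,2)$, the exponent $1$ in the upper bound $\mathbb E|B^{\mathcal H}_\alpha(t)-B^{\mathcal H}_\alpha(s)|^2\le C(t-s)$, $0\le s\le t\le T$, cannot be replaced by a larger one: for every $\beta>1$ there is no constant $C>0$ such that $\mathbb E|B^{\mathcal H}_\alpha(t)-B^{\mathcal H}_\alpha(s)|^2\le C(t-s)^{\beta}$ for all $0\le s\le t\le T$.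
   Context: Let $B=\{B(t)\}_{t\ge0}$ be a standard Brownian motion. For $\alpha>0$ the Hadamard fractional Brownian motion is the centered Gaussian process $B^{\mathcal H}_\alpha=\{B^{\mathcal H}_\alpha(t)\}_{t\ge 0}$ given by $B^{\mathcal H}_\alpha(0)=0$ and the Wiener integral $$B^{\mathcal H}_\alpha(t)=\frac1{\sqrt{\Gamma(\alpha)}}\int_0^t\Big(\log\frac ts\Big)^{(\alpha-1)/2}dB(s),\qquad t>0.$$ *)

theory Defs
  imports "HOL-Probability.Probability"
begin

locale standard_brownian_motion = prob_space M for M :: "'a measure" +
  fixes B :: "real \<Rightarrow> 'a \<Rightarrow> real"
  assumes BM_measurable: "t \<ge> 0 \<Longrightarrow> B t \<in> borel_measurable M"
    and BM_zero: "AE \<omega> in M. B 0 \<omega> = 0"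
    and BM_indep_increments:
      "\<lbrakk>0 \<le> \<tau> 0; \<And>i. i < n \<Longrightarrow> \<tau> i \<le> \<tau> (Suc i)\<rbrakk> \<Longrightarrow>
        indep_vars (\<lambda>_. borel) (\<lambda>i \<omega>. B (\<tau> (Suc i)) \<omega> - B (\<tau> i) \<omega>) {..<n::nat}"
    and BM_normal_increments:
      "\<lbrakk>0 \<le> s; s < t\<rbrakk> \<Longrightarrow>
        distributed M lborel (\<lambda>\<omega>. B t \<omega> - B s \<omega>) (normal_density 0 (sqrt (t - s)))"
    and BM_continuous: "AE \<omega> in M. continuous_on {0..} (\<lambda>t. B t \<omega>)"

text \<open>
  A list of triples \<open>(c, a, b)\<close> with \<open>0 \<le> a \<le> b \<le> t\<close> represents the step function
  \<open>\<Sum> c * indicator {a<..b}\<close> on \<open>[0, t]\<close>. The intervals need not be disjoint; since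
  increments of \<open>B\<close> are additive, the elementary integral depends only on the step function,
  not on the list representing it.
\<close>

definition step_on :: "real \<Rightarrow> (real \<times> real \<times> real) list \<Rightarrow> bool" where
  "step_on t \<sigma> \<longleftrightarrow> (\<forall>(c, a, b) \<in> set \<sigma>. 0 \<le> a \<and> a \<le> b \<and> b \<le> t)"

definition step_fun :: "(real \<times> real \<times> real) list \<Rightarrow> real \<Rightarrow> real" where
  "step_fun \<sigma> u = (\<Sum>(c, a, b)\<leftarrow>\<sigma>. c * indicator {a<..b} u)"

definition step_integral ::
    "(real \<Rightarrow> 'a \<Rightarrow> real) \<Rightarrow> (real \<times> real \<times> real) list \<Rightarrow> 'a \<Rightarrow> real" where
  "step_integral B \<sigma> \<omega> = (\<Sum>(c, a, b)\<leftarrow>\<sigma>. c * (B b \<omega> - B a \<omega>))"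

text \<open>
  \<open>Y\<close> is a version of the Wiener integral of \<open>f\<close> over \<open>[0, t]\<close>: the limit in \<open>L\<^sup>2\<close> of
  elementary integrals of step functions converging to \<open>f\<close> in \<open>L\<^sup>2([0, t])\<close>. As usual, the
  integral is determined only up to almost sure equality, hence a relation. Distances are
  measured with the nonnegative integral, so that convergence to \<open>0\<close> forces \<open>f\<close> and \<open>Y\<close> to be
  square integrable.
\<close>

definition has_wiener_integral ::
    "'a measure \<Rightarrow> (real \<Rightarrow> 'a \<Rightarrow> real) \<Rightarrow> real \<Rightarrow> (real \<Rightarrow> real) \<Rightarrow> ('a \<Rightarrow> real) \<Rightarrow> bool" where
  "has_wiener_integral M B t f Y \<longleftrightarrow>
     set_borel_measurable lborel {0..t} f \<and> Y \<in> borel_measurable M \<and>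
     (\<exists>\<sigma> :: nat \<Rightarrow> (real \<times> real \<times> real) list.
        (\<forall>n. step_on t (\<sigma> n)) \<and>
        (\<lambda>n. \<integral>\<^sup>+ u \<in> {0..t}. ennreal ((step_fun (\<sigma> n) u - f u)\<^sup>2) \<partial>lborel) \<longlonglongrightarrow> 0 \<and>
        (\<lambda>n. \<integral>\<^sup>+ \<omega>. ennreal ((step_integral B (\<sigma> n) \<omega> - Y \<omega>)\<^sup>2) \<partial>M) \<longlonglongrightarrow> 0)"

text \<open>
  The values that the integrand takes at \<open>s = 0\<close> and \<open>s = t\<close> by HOL's conventions for division,
  \<open>ln\<close> and \<open>powr\<close> are irrelevant, as these points form a null set.
\<close>

definition hadamard_fbm ::
    "'a measure \<Rightarrow> (real \<Rightarrow> 'a \<Rightarrow> real) \<Rightarrow> real \<Rightarrow> (real \<Rightarrow> 'a \<Rightarrow> real) \<Rightarrow> bool" where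
  "hadamard_fbm M B \<alpha> X \<longleftrightarrow>
     (\<forall>\<omega> \<in> space M. X 0 \<omega> = 0) \<and>
     (\<forall>t > 0. \<exists>Y. has_wiener_integral M B t (\<lambda>s. ln (t / s) powr ((\<alpha> - 1) / 2)) Y \<and>
        (\<forall>\<omega> \<in> space M. X t \<omega> = 1 / sqrt (Gamma \<alpha>) * Y \<omega>))"

end

theory Submission
  imports Defs
begin

text \<open>
  Both parts need only a lower bound for \<open>E (X t - X s)\<^sup>2\<close>, and only up to a constant factor. On
  \<open>{s<..t}\<close> the integrand of \<open>X s\<close> is absent, so the Wiener isometry bounds \<open>E (X t - X s)\<^sup>2\<close>
  from below by a multiple of the integral of \<open>ln (t / u) powr (\<alpha> - 1)\<close> over \<open>{s<..t}\<close>
  (\<open>hadamard_fbm_increment_lower_bound\<close>).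

  For \<open>\<alpha> < 1\<close> the kernel blows up on the diagonal. With \<open>t = T\<close> and \<open>s = T - h\<close>, where
  \<open>h \<le> T / 2\<close>, the inequality \<open>ln (T / u) \<le> T / u - 1 \<le> 2 * h / T\<close> makes the kernel at least of
  order \<open>h powr (\<alpha> - 1)\<close> on an interval of length \<open>h\<close>; so the increment has second moment at least
  of order \<open>h powr \<alpha>\<close>.

  For \<open>\<alpha> > 1\<close> the exponent \<open>1\<close> is forced at the origin: the second moment of \<open>X t\<close> is of exact
  order \<open>t\<close> by scaling, and the part \<open>u \<le> t / e\<close>, where \<open>ln (t / u) \<ge> 1\<close>, already gives the lower
  bound. A power \<open>h powr q\<close> cannot dominate \<open>h powr p\<close> near \<open>0\<close> if \<open>q > p\<close>.

  The isometry for step functions is obtained from the identity \<open>E (B t - B s)\<^sup>2 = t - s\<close>.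
  By polarization the variances of the increments determine all covariances of increments, hence the
  second moment of every elementary integral. The deterministic process \<open>t \<mapsto> indicator {0<..t}\<close>
  on the real line with Lebesgue measure has the same increment variances, and its elementary
  integrals are the step functions themselves.
\<close>

section \<open>Second moments of elementary integrals\<close>

lemma has_bochner_integral_sum_list:
  fixes f :: "'b \<Rightarrow> 'a \<Rightarrow> real"
  assumes "\<And>x. x \<in> set xs \<Longrightarrow> has_bochner_integral N (f x) (m x)"
  shows "has_bochner_integral N (\<lambda>\<omega>. \<Sum>x\<leftarrow>xs. f x \<omega>) (\<Sum>x\<leftarrow>xs. m x)"
  using assms by (induction xs) (auto intro!: has_bochner_integral_add)

lemma sum_list_power2:
  fixes f :: "'b \<Rightarrow> real"
  shows "(\<Sum>x\<leftarrow>xs. f x)\<^sup>2 = (\<Sum>x\<leftarrow>xs. \<Sum>y\<leftarrow>xs. f x * f y)"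
  by (simp add: power2_eq_square sum_list_mult_const[symmetric] sum_list_const_mult[symmetric] mult.commute)

text \<open>
  For \<open>a \<le> b\<close> and \<open>c \<le> d\<close> this is the length of the intersection of \<open>{a<..b}\<close> and \<open>{c<..d}\<close>;
  it is written in the form that polarization produces.
\<close>

definition increment_covariance :: "real \<Rightarrow> real \<Rightarrow> real \<Rightarrow> real \<Rightarrow> real" where
  "increment_covariance a b c d = (\<bar>b - c\<bar> + \<bar>a - d\<bar> - \<bar>b - d\<bar> - \<bar>a - c\<bar>) / 2"

text \<open>
  The product of two increments is a linear combination of squares of increments, namely
  \<open>2 * (w - x) * (y - z) = (w - z)\<^sup>2 + (x - y)\<^sup>2 - (w - y)\<^sup>2 - (x - z)\<^sup>2\<close>.
  So the variances of the increments determine their covariances; in particular, increments over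
  disjoint intervals are orthogonal.
\<close>

lemma increment_product_expectation:
  fixes W :: "real \<Rightarrow> 'a \<Rightarrow> real"
  assumes var: "\<And>s t. 0 \<le> s \<Longrightarrow> s \<le> t \<Longrightarrow> has_bochner_integral N (\<lambda>\<omega>. (W t \<omega> - W s \<omega>)\<^sup>2) (t - s)"
    and nonneg: "0 \<le> a" "0 \<le> b" "0 \<le> c" "0 \<le> d"
  shows "has_bochner_integral N (\<lambda>\<omega>. (W b \<omega> - W a \<omega>) * (W d \<omega> - W c \<omega>)) (increment_covariance a b c d)"
proof -
  have sym: "has_bochner_integral N (\<lambda>\<omega>. (W t \<omega> - W s \<omega>)\<^sup>2) \<bar>t - s\<bar>" if "0 \<le> s" "0 \<le> t" for s t
    using var[of s t] var[of t s] that by (cases "s \<le> t") (auto simp: power2_commute)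
  have "has_bochner_integral N
     (\<lambda>\<omega>. ((W b \<omega> - W c \<omega>)\<^sup>2 + (W a \<omega> - W d \<omega>)\<^sup>2 - (W b \<omega> - W d \<omega>)\<^sup>2 - (W a \<omega> - W c \<omega>)\<^sup>2) / 2)
     (increment_covariance a b c d)"
    unfolding increment_covariance_def
    by (intro has_bochner_integral_divide_zero has_bochner_integral_diff has_bochner_integral_add sym nonneg)
  moreover have "((W b \<omega> - W c \<omega>)\<^sup>2 + (W a \<omega> - W d \<omega>)\<^sup>2 - (W b \<omega> - W d \<omega>)\<^sup>2 - (W a \<omega> - W c \<omega>)\<^sup>2) / 2
      = (W b \<omega> - W a \<omega>) * (W d \<omega> - W c \<omega>)" for \<omega>
    by (simp add: power2_eq_square field_simps)
  ultimately show ?thesis by simp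
qed

text \<open>
  The value on the right depends on \<open>\<sigma>\<close> only, not on the process; this is what makes
  two processes with the same increment variances comparable.
\<close>

lemma step_integral_second_moment:
  fixes W :: "real \<Rightarrow> 'a \<Rightarrow> real"
  assumes var: "\<And>s t. 0 \<le> s \<Longrightarrow> s \<le> t \<Longrightarrow> has_bochner_integral N (\<lambda>\<omega>. (W t \<omega> - W s \<omega>)\<^sup>2) (t - s)"
    and "step_on t \<sigma>"
  shows "has_bochner_integral N (\<lambda>\<omega>. (step_integral W \<sigma> \<omega>)\<^sup>2)
    (\<Sum>(c, a, b)\<leftarrow>\<sigma>. \<Sum>(c', a', b')\<leftarrow>\<sigma>. c * c' * increment_covariance a b a' b')"
proof -
  have "has_bochner_integral N
      (\<lambda>\<omega>. (case x of (c, a, b) \<Rightarrow> c * (W b \<omega> - W a \<omega>)) * (case y of (c, a, b) \<Rightarrow> c * (W b \<omega> - W a \<omega>)))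
      (case x of (c, a, b) \<Rightarrow> case y of (c', a', b') \<Rightarrow> c * c' * increment_covariance a b a' b')"
    if "x \<in> set \<sigma>" "y \<in> set \<sigma>" for x y
  proof -
    obtain c a b c' a' b' where xy: "x = (c, a, b)" "y = (c', a', b')"
      by (metis prod_cases3)
    have "0 \<le> a" "0 \<le> b" "0 \<le> a'" "0 \<le> b'"
      using assms(2) that unfolding step_on_def xy by fastforce+
    then have "has_bochner_integral N (\<lambda>\<omega>. c * c' * ((W b \<omega> - W a \<omega>) * (W b' \<omega> - W a' \<omega>)))
        (c * c' * increment_covariance a b a' b')"
      by (intro has_bochner_integral_mult_right increment_product_expectation var)
    then show ?thesis
      by (simp add: xy mult_ac)
  qed
  then have "has_bochner_integral N (\<lambda>\<omega>. (step_integral W \<sigma> \<omega>)\<^sup>2)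
    (\<Sum>x\<leftarrow>\<sigma>. \<Sum>y\<leftarrow>\<sigma>. case x of (c, a, b) \<Rightarrow> case y of (c', a', b') \<Rightarrow> c * c' * increment_covariance a b a' b')"
    unfolding step_integral_def sum_list_power2
    by (intro has_bochner_integral_sum_list)
  then show ?thesis
    by (simp add: case_prod_unfold)
qed

lemma brownian_increment_second_moment:
  assumes "standard_brownian_motion M B" "0 \<le> s" "s \<le> t"
  shows "has_bochner_integral M (\<lambda>\<omega>. (B t \<omega> - B s \<omega>)\<^sup>2) (t - s)"
proof (cases "s = t")
  case True
  then show ?thesis by (simp add: has_bochner_integral_zero)
next
  case False
  interpret standard_brownian_motion M B by fact
  have pos: "0 < sqrt (t - s)" using False assms by simp
  have dist: "distributed M lborel (\<lambda>\<omega>. B t \<omega> - B s \<omega>) (normal_density 0 (sqrt (t - s)))"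
    using BM_normal_increments[of s t] assms False by simp
  have mom: "has_bochner_integral lborel (\<lambda>x. normal_density 0 (sqrt (t - s)) x * x\<^sup>2) (t - s)"
    using normal_moment_even[OF pos, of 0 1] pos by (simp add: fact_numeral field_simps power2_eq_square)
  have "integrable M (\<lambda>\<omega>. (B t \<omega> - B s \<omega>)\<^sup>2)"
    using distributed_integrable[OF dist, of "\<lambda>x. x\<^sup>2"] mom by (auto simp: has_bochner_integral_iff)
  moreover have "(\<integral>\<omega>. (B t \<omega> - B s \<omega>)\<^sup>2 \<partial>M) = t - s"
    using distributed_integral[OF dist, of "\<lambda>x. x\<^sup>2"] mom by (auto simp: has_bochner_integral_iff)
  ultimately show ?thesis by (simp add: has_bochner_integral_iff)
qed

lemma indicator_increment_second_moment:
  fixes s t :: real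
  assumes "0 \<le> s" "s \<le> t"
  shows "has_bochner_integral lborel (\<lambda>u. (indicator {0<..t} u - indicator {0<..s} u :: real)\<^sup>2) (t - s)"
proof -
  have "(indicator {0<..t} u - indicator {0<..s} u :: real)\<^sup>2 = indicator {s<..t} u" for u
    using assms by (auto simp: indicator_def)
  then show ?thesis
    using has_bochner_integral_real_indicator[of "{s<..t}" lborel] assms by simp
qed

lemma step_fun_eq_step_integral:
  assumes "step_on t \<sigma>"
  shows "step_fun \<sigma> u = step_integral (\<lambda>t. indicator {0<..t}) \<sigma> u"
proof -
  have "c * indicator {a<..b} u = c * (indicator {0<..b} u - indicator {0<..a} u)"
    if "(c, a, b) \<in> set \<sigma>" for c a b
    using assms that by (fastforce simp: step_on_def indicator_def)
  then show ?thesis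
    unfolding step_fun_def step_integral_def by (intro arg_cong[of _ _ sum_list] map_cong) auto
qed

lemma step_integral_isometry:
  assumes "standard_brownian_motion M B" "step_on t \<sigma>"
  shows "(\<integral>\<^sup>+\<omega>. ennreal ((step_integral B \<sigma> \<omega>)\<^sup>2) \<partial>M) = (\<integral>\<^sup>+u. ennreal ((step_fun \<sigma> u)\<^sup>2) \<partial>lborel)"
    and "integrable M (\<lambda>\<omega>. (step_integral B \<sigma> \<omega>)\<^sup>2)"
proof -
  note BM = step_integral_second_moment[OF brownian_increment_second_moment[OF assms(1)] assms(2)]
  note ind = step_integral_second_moment[OF indicator_increment_second_moment assms(2)]
  show "integrable M (\<lambda>\<omega>. (step_integral B \<sigma> \<omega>)\<^sup>2)"
    using BM by (auto simp: has_bochner_integral_iff)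
  show "(\<integral>\<^sup>+\<omega>. ennreal ((step_integral B \<sigma> \<omega>)\<^sup>2) \<partial>M) = (\<integral>\<^sup>+u. ennreal ((step_fun \<sigma> u)\<^sup>2) \<partial>lborel)"
    using BM ind unfolding step_fun_eq_step_integral[OF assms(2)]
    by (simp add: has_bochner_integral_iff nn_integral_eq_integral)
qed

section \<open>Lower bounds for differences of Wiener integrals\<close>

lemma square_le_twice_sum:
  fixes x y :: real
  shows "x\<^sup>2 \<le> 2 * y\<^sup>2 + 2 * (x - y)\<^sup>2"
  using zero_le_power2[of "x - 2 * y"] by (simp add: power2_eq_square algebra_simps)

lemma ennreal_square_le_twice_sum:
  fixes x y :: real
  shows "ennreal (x\<^sup>2) \<le> 2 * ennreal (y\<^sup>2) + 2 * ennreal ((x - y)\<^sup>2)"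
proof -
  have "ennreal (x\<^sup>2) \<le> ennreal (2 * y\<^sup>2 + 2 * (x - y)\<^sup>2)"
    by (intro ennreal_leI square_le_twice_sum)
  also have "\<dots> = 2 * ennreal (y\<^sup>2) + 2 * ennreal ((x - y)\<^sup>2)"
    by (simp add: ennreal_plus ennreal_mult)
  finally show ?thesis .
qed

lemma step_fun_measurable [measurable]: "step_fun \<sigma> \<in> borel_measurable borel"
  unfolding step_fun_def[abs_def] by (induction \<sigma>) (auto split: prod.split)

lemma step_integral_measurable:
  assumes "standard_brownian_motion M B" "step_on t \<sigma>"
  shows "step_integral B \<sigma> \<in> borel_measurable M"
proof -
  interpret standard_brownian_motion M B by fact
  show ?thesis
    using assms(2) unfolding step_integral_def[abs_def] step_on_def
  proof (induction \<sigma>)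
    case (Cons x \<sigma>)
    obtain c a b where x: "x = (c, a, b)" by (metis prod_cases3)
    have [measurable]: "B a \<in> borel_measurable M" "B b \<in> borel_measurable M"
      using Cons.prems by (auto simp: x intro!: BM_measurable)
    have [measurable]: "(\<lambda>\<omega>. \<Sum>(c, a, b)\<leftarrow>\<sigma>. c * (B b \<omega> - B a \<omega>)) \<in> borel_measurable M"
      using Cons by auto
    show ?case by (simp add: x)
  qed simp
qed

definition step_uminus :: "(real \<times> real \<times> real) list \<Rightarrow> (real \<times> real \<times> real) list" where
  "step_uminus = map (\<lambda>(c, a, b). (- c, a, b))"

lemma step_fun_append_uminus: "step_fun (\<sigma> @ step_uminus \<tau>) u = step_fun \<sigma> u - step_fun \<tau> u"
  unfolding step_fun_def step_uminus_def by (induction \<tau>) auto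

lemma step_integral_append_uminus:
  "step_integral B (\<sigma> @ step_uminus \<tau>) \<omega> = step_integral B \<sigma> \<omega> - step_integral B \<tau> \<omega>"
  unfolding step_integral_def step_uminus_def by (induction \<tau>) (auto simp: algebra_simps)

lemma step_on_append_uminus:
  "step_on t \<sigma> \<Longrightarrow> step_on s \<tau> \<Longrightarrow> s \<le> t \<Longrightarrow> step_on t (\<sigma> @ step_uminus \<tau>)"
  unfolding step_on_def step_uminus_def by fastforce

lemma step_fun_eq_0:
  assumes "step_on s \<tau>" "s < u"
  shows "step_fun \<tau> u = 0"
  using assms unfolding step_on_def step_fun_def by (induction \<tau>) auto

lemma has_wiener_integral_square_integrable:
  assumes BM: "standard_brownian_motion M B" and Y: "has_wiener_integral M B t f Y"
  shows "integrable M (\<lambda>\<omega>. (Y \<omega>)\<^sup>2)"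
proof -
  obtain \<sigma> where \<sigma>: "\<And>n. step_on t (\<sigma> n)"
    and lim: "(\<lambda>n. \<integral>\<^sup>+\<omega>. ennreal ((step_integral B (\<sigma> n) \<omega> - Y \<omega>)\<^sup>2) \<partial>M) \<longlonglongrightarrow> 0"
    and [measurable]: "Y \<in> borel_measurable M"
    using Y unfolding has_wiener_integral_def by blast
  have "eventually (\<lambda>n. (\<integral>\<^sup>+\<omega>. ennreal ((step_integral B (\<sigma> n) \<omega> - Y \<omega>)\<^sup>2) \<partial>M) < \<infinity>) sequentially"
    using order_tendstoD(2)[OF lim, of \<infinity>] by simp
  then obtain n where n: "(\<integral>\<^sup>+\<omega>. ennreal ((step_integral B (\<sigma> n) \<omega> - Y \<omega>)\<^sup>2) \<partial>M) < \<infinity>"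
    by (auto dest: eventually_happens)
  define I where "I = step_integral B (\<sigma> n)"
  have [measurable]: "I \<in> borel_measurable M"
    unfolding I_def using step_integral_measurable[OF BM \<sigma>] .
  have "integrable M (\<lambda>\<omega>. (I \<omega>)\<^sup>2)"
    unfolding I_def using step_integral_isometry(2)[OF BM \<sigma>] .
  moreover have "integrable M (\<lambda>\<omega>. (I \<omega> - Y \<omega>)\<^sup>2)"
    using n by (intro integrableI_nonneg) (auto simp: I_def[symmetric])
  ultimately have "integrable M (\<lambda>\<omega>. 2 * (I \<omega>)\<^sup>2 + 2 * (I \<omega> - Y \<omega>)\<^sup>2)"
    by simp
  then show ?thesis
    by (rule Bochner_Integration.integrable_bound)
      (auto simp: power2_commute[of "I _"] intro: square_le_twice_sum)
qed

text \<open>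
  Approximate \<open>Y\<close> and \<open>Z\<close> by elementary integrals of \<open>\<sigma>\<close> and \<open>\<tau>\<close>. Since \<open>\<tau>\<close> lives on
  \<open>{0<..s}\<close>, the isometry for \<open>\<sigma> - \<tau>\<close> bounds the second moment of the difference from below by the
  integral of \<open>\<sigma>\<^sup>2\<close> over \<open>{s<..t}\<close>. The sharp constant is \<open>1\<close>; using the inequality
  \<open>x\<^sup>2 \<le> 2 * y\<^sup>2 + 2 * (x - y)\<^sup>2\<close> for both passages to the limit costs the factor \<open>4\<close>.
\<close>

lemma wiener_integral_diff_lower_bound:
  assumes BM: "standard_brownian_motion M B"
    and st: "0 \<le> s" "s \<le> t"
    and Y: "has_wiener_integral M B t f Y" and Z: "has_wiener_integral M B s g Z"
  shows "(\<integral>\<^sup>+u\<in>{s<..t}. ennreal ((f u)\<^sup>2) \<partial>lborel) \<le> 4 * (\<integral>\<^sup>+\<omega>. ennreal ((Y \<omega> - Z \<omega>)\<^sup>2) \<partial>M)"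
proof -
  obtain \<sigma> where \<sigma>: "\<And>n. step_on t (\<sigma> n)"
    and lim_f: "(\<lambda>n. \<integral>\<^sup>+u\<in>{0..t}. ennreal ((step_fun (\<sigma> n) u - f u)\<^sup>2) \<partial>lborel) \<longlonglongrightarrow> 0"
    and lim_Y: "(\<lambda>n. \<integral>\<^sup>+\<omega>. ennreal ((step_integral B (\<sigma> n) \<omega> - Y \<omega>)\<^sup>2) \<partial>M) \<longlonglongrightarrow> 0"
    and f: "set_borel_measurable lborel {0..t} f"
    and [measurable]: "Y \<in> borel_measurable M"
    using Y unfolding has_wiener_integral_def by blast
  obtain \<tau> where \<tau>: "\<And>n. step_on s (\<tau> n)"
    and lim_Z: "(\<lambda>n. \<integral>\<^sup>+\<omega>. ennreal ((step_integral B (\<tau> n) \<omega> - Z \<omega>)\<^sup>2) \<partial>M) \<longlonglongrightarrow> 0"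
    and [measurable]: "Z \<in> borel_measurable M"
    using Z unfolding has_wiener_integral_def by blast
  define err_f where "err_f n = (\<integral>\<^sup>+u\<in>{0..t}. ennreal ((step_fun (\<sigma> n) u - f u)\<^sup>2) \<partial>lborel)" for n
  define err_Y where "err_Y n = (\<integral>\<^sup>+\<omega>. ennreal ((step_integral B (\<sigma> n) \<omega> - Y \<omega>)\<^sup>2) \<partial>M)" for n
  define err_Z where "err_Z n = (\<integral>\<^sup>+\<omega>. ennreal ((step_integral B (\<tau> n) \<omega> - Z \<omega>)\<^sup>2) \<partial>M)" for n
  define D where "D = (\<integral>\<^sup>+\<omega>. ennreal ((Y \<omega> - Z \<omega>)\<^sup>2) \<partial>M)"
  define F where "F u = indicator {0..t} u * f u" for u
  have [measurable]: "F \<in> borel_measurable borel"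
    using f unfolding F_def[abs_def] set_borel_measurable_def by simp
  have bound: "(\<integral>\<^sup>+u\<in>{s<..t}. ennreal ((f u)\<^sup>2) \<partial>lborel) \<le> 2 * (2 * D + 2 * (2 * err_Y n + 2 * err_Z n)) + 2 * err_f n"
    for n
  proof -
    let ?I = "step_integral B (\<sigma> n)" and ?J = "step_integral B (\<tau> n)"
    let ?\<rho> = "\<sigma> n @ step_uminus (\<tau> n)"
    have [measurable]: "?I \<in> borel_measurable M" "?J \<in> borel_measurable M"
      using step_integral_measurable[OF BM] \<sigma> \<tau> by auto
    have "(\<integral>\<^sup>+u\<in>{s<..t}. ennreal ((f u)\<^sup>2) \<partial>lborel)
        \<le> (\<integral>\<^sup>+u. 2 * ennreal ((step_fun ?\<rho> u)\<^sup>2)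
              + 2 * (ennreal ((step_fun (\<sigma> n) u - F u)\<^sup>2) * indicator {0..t} u) \<partial>lborel)"
    proof (intro nn_integral_mono)
      fix u
      show "ennreal ((f u)\<^sup>2) * indicator {s<..t} u \<le> 2 * ennreal ((step_fun ?\<rho> u)\<^sup>2)
              + 2 * (ennreal ((step_fun (\<sigma> n) u - F u)\<^sup>2) * indicator {0..t} u)"
      proof (cases "u \<in> {s<..t}")
        case True
        then have "step_fun ?\<rho> u = step_fun (\<sigma> n) u" "F u = f u" "u \<in> {0..t}"
          using step_fun_eq_0[OF \<tau>, of u n] st by (auto simp: step_fun_append_uminus F_def)
        then show ?thesis
          using ennreal_square_le_twice_sum[of "f u" "step_fun (\<sigma> n) u"] True
          by (simp add: power2_commute[of "f u"])
      qed simp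
    qed
    also have "\<dots> = 2 * (\<integral>\<^sup>+u. ennreal ((step_fun ?\<rho> u)\<^sup>2) \<partial>lborel)
        + 2 * (\<integral>\<^sup>+u\<in>{0..t}. ennreal ((step_fun (\<sigma> n) u - F u)\<^sup>2) \<partial>lborel)"
      by (simp add: nn_integral_add nn_integral_cmult)
    also have "(\<integral>\<^sup>+u\<in>{0..t}. ennreal ((step_fun (\<sigma> n) u - F u)\<^sup>2) \<partial>lborel) = err_f n"
      unfolding err_f_def by (intro nn_integral_cong) (auto simp: F_def indicator_def)
    also have "(\<integral>\<^sup>+u. ennreal ((step_fun ?\<rho> u)\<^sup>2) \<partial>lborel) = (\<integral>\<^sup>+\<omega>. ennreal ((step_integral B ?\<rho> \<omega>)\<^sup>2) \<partial>M)"
      using step_integral_isometry(1)[OF BM step_on_append_uminus[OF \<sigma> \<tau> st(2)]] by simp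
    also have "\<dots> \<le> (\<integral>\<^sup>+\<omega>. 2 * ennreal ((Y \<omega> - Z \<omega>)\<^sup>2) + 2 * (2 * ennreal ((?I \<omega> - Y \<omega>)\<^sup>2) + 2 * ennreal ((?J \<omega> - Z \<omega>)\<^sup>2)) \<partial>M)"
    proof (intro nn_integral_mono)
      fix \<omega>
      have "ennreal ((step_integral B ?\<rho> \<omega>)\<^sup>2)
          \<le> 2 * ennreal ((Y \<omega> - Z \<omega>)\<^sup>2) + 2 * ennreal ((?I \<omega> - ?J \<omega> - (Y \<omega> - Z \<omega>))\<^sup>2)"
        unfolding step_integral_append_uminus by (rule ennreal_square_le_twice_sum)
      also have "ennreal ((?I \<omega> - ?J \<omega> - (Y \<omega> - Z \<omega>))\<^sup>2) \<le> 2 * ennreal ((?I \<omega> - Y \<omega>)\<^sup>2) + 2 * ennreal ((?J \<omega> - Z \<omega>)\<^sup>2)"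
        using ennreal_square_le_twice_sum[of "?I \<omega> - ?J \<omega> - (Y \<omega> - Z \<omega>)" "?I \<omega> - Y \<omega>"]
        by (simp add: algebra_simps power2_commute[of "Z \<omega>"])
      finally show "ennreal ((step_integral B ?\<rho> \<omega>)\<^sup>2)
          \<le> 2 * ennreal ((Y \<omega> - Z \<omega>)\<^sup>2) + 2 * (2 * ennreal ((?I \<omega> - Y \<omega>)\<^sup>2) + 2 * ennreal ((?J \<omega> - Z \<omega>)\<^sup>2))"
        by (simp add: mult_left_mono add_left_mono)
    qed
    also have "\<dots> = 2 * D + 2 * (2 * err_Y n + 2 * err_Z n)"
      unfolding D_def err_Y_def err_Z_def by (simp add: nn_integral_add nn_integral_cmult)
    finally show ?thesis
      by (simp add: mult_left_mono add_right_mono)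
  qed
  have "(\<lambda>n. 2 * (2 * D + 2 * (2 * err_Y n + 2 * err_Z n)) + 2 * err_f n)
      \<longlonglongrightarrow> 2 * (2 * D + 2 * (2 * 0 + 2 * 0)) + 2 * 0"
    using lim_f lim_Y lim_Z unfolding err_f_def[symmetric] err_Y_def[symmetric] err_Z_def[symmetric]
    by (intro tendsto_add ennreal_tendsto_cmult tendsto_const) auto
  then have "(\<integral>\<^sup>+u\<in>{s<..t}. ennreal ((f u)\<^sup>2) \<partial>lborel) \<le> 2 * (2 * D + 2 * (2 * 0 + 2 * 0)) + 2 * 0"
    using bound by (intro LIMSEQ_le_const) auto
  then show ?thesis
    by (simp add: D_def mult.assoc[symmetric])
qed

section \<open>Increments of the Hadamard fractional Brownian motion\<close>

lemma hadamard_fbm_wiener_integral: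
  assumes "hadamard_fbm M B \<alpha> X" "t > 0"
  obtains Y where "has_wiener_integral M B t (\<lambda>s. ln (t / s) powr ((\<alpha> - 1) / 2)) Y"
    "\<And>\<omega>. \<omega> \<in> space M \<Longrightarrow> X t \<omega> = 1 / sqrt (Gamma \<alpha>) * Y \<omega>"
  using assms unfolding hadamard_fbm_def by blast

text \<open>
  At \<open>t = 0\<close>, where \<open>X 0 = 0\<close> holds by definition, the integrand \<open>0\<close> serves. This lets the
  increments that start at the origin be treated like all others.
\<close>

lemma hadamard_fbm_wiener_integral_nonneg:
  assumes "hadamard_fbm M B \<alpha> X" "t \<ge> 0"
  obtains f Y where "has_wiener_integral M B t f Y"
    "\<And>\<omega>. \<omega> \<in> space M \<Longrightarrow> X t \<omega> = 1 / sqrt (Gamma \<alpha>) * Y \<omega>"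
proof (cases "t = 0")
  case True
  have "has_wiener_integral M B t (\<lambda>_. 0) (\<lambda>_. 0)"
    unfolding has_wiener_integral_def set_borel_measurable_def
    by (auto intro!: exI[of _ "\<lambda>_. []"] simp: step_on_def step_fun_def step_integral_def)
  then show ?thesis
    using that[of "\<lambda>_. 0" "\<lambda>_. 0"] assms True by (auto simp: hadamard_fbm_def)
next
  case False
  then have "t > 0" using assms(2) by simp
  then show ?thesis
    using hadamard_fbm_wiener_integral[OF assms(1)] that by blast
qed

lemma hadamard_fbm_increment_lower_bound:
  assumes BM: "standard_brownian_motion M B" and X: "hadamard_fbm M B \<alpha> X" and \<alpha>: "\<alpha> > 0"
    and st: "0 \<le> s" "s < t"
    and ab: "s \<le> a" "a \<le> b" "b \<le> t"
    and k: "k \<ge> 0" "\<And>u. a < u \<Longrightarrow> u < b \<Longrightarrow> k \<le> ln (t / u) powr (\<alpha> - 1)"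
  shows "k * (b - a) \<le> 4 * Gamma \<alpha> * (\<integral>\<omega>. \<bar>X t \<omega> - X s \<omega>\<bar>\<^sup>2 \<partial>M)"
proof -
  define f where "f = (\<lambda>s. ln (t / s) powr ((\<alpha> - 1) / 2))"
  obtain Y where Y: "has_wiener_integral M B t f Y" "\<And>\<omega>. \<omega> \<in> space M \<Longrightarrow> X t \<omega> = 1 / sqrt (Gamma \<alpha>) * Y \<omega>"
    using hadamard_fbm_wiener_integral[OF X order_le_less_trans[OF st]] unfolding f_def by blast
  obtain g Z where Z: "has_wiener_integral M B s g Z" "\<And>\<omega>. \<omega> \<in> space M \<Longrightarrow> X s \<omega> = 1 / sqrt (Gamma \<alpha>) * Z \<omega>"
    using hadamard_fbm_wiener_integral_nonneg[OF X st(1)] by blast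
  have [measurable]: "Y \<in> borel_measurable M" "Z \<in> borel_measurable M"
    using Y Z by (auto simp: has_wiener_integral_def)
  have "integrable M (\<lambda>\<omega>. 2 * (Z \<omega>)\<^sup>2 + 2 * (Y \<omega>)\<^sup>2)"
    using has_wiener_integral_square_integrable[OF BM] Y(1) Z(1) by auto
  then have int: "integrable M (\<lambda>\<omega>. (Y \<omega> - Z \<omega>)\<^sup>2)"
  proof (rule Bochner_Integration.integrable_bound)
    have "(Y \<omega> - Z \<omega>)\<^sup>2 \<le> 2 * (Z \<omega>)\<^sup>2 + 2 * (Y \<omega>)\<^sup>2" for \<omega>
      using square_le_twice_sum[of "Y \<omega> - Z \<omega>" "- Z \<omega>"] by simp
    then show "AE \<omega> in M. norm ((Y \<omega> - Z \<omega>)\<^sup>2) \<le> norm (2 * (Z \<omega>)\<^sup>2 + 2 * (Y \<omega>)\<^sup>2)"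
      by simp
  qed simp
  have G: "Gamma \<alpha> > 0" using \<alpha> by (rule Gamma_real_pos)
  have "(\<integral>\<omega>. \<bar>X t \<omega> - X s \<omega>\<bar>\<^sup>2 \<partial>M) = (\<integral>\<omega>. (Y \<omega> - Z \<omega>)\<^sup>2 / Gamma \<alpha> \<partial>M)"
    using Y(2) Z(2) G
    by (intro Bochner_Integration.integral_cong)
      (auto simp: diff_divide_distrib[symmetric] power_divide)
  then have X_eq: "Gamma \<alpha> * (\<integral>\<omega>. \<bar>X t \<omega> - X s \<omega>\<bar>\<^sup>2 \<partial>M) = (\<integral>\<omega>. (Y \<omega> - Z \<omega>)\<^sup>2 \<partial>M)"
    using G by simp
  have "ennreal (k * (b - a)) = (\<integral>\<^sup>+u. ennreal k * indicator {a<..<b} u \<partial>lborel)"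
    using k(1) ab by (simp add: nn_integral_cmult ennreal_mult)
  also have "\<dots> \<le> (\<integral>\<^sup>+u\<in>{s<..t}. ennreal ((f u)\<^sup>2) \<partial>lborel)"
  proof (intro nn_integral_mono)
    fix u
    have "(f u)\<^sup>2 = ln (t / u) powr (\<alpha> - 1)"
      by (simp add: f_def power2_eq_square powr_add[symmetric])
    then show "ennreal k * indicator {a<..<b} u \<le> ennreal ((f u)\<^sup>2) * indicator {s<..t} u"
      using k(2)[of u] ab by (auto simp: indicator_def intro!: ennreal_leI)
  qed
  also have "\<dots> \<le> 4 * (\<integral>\<^sup>+\<omega>. ennreal ((Y \<omega> - Z \<omega>)\<^sup>2) \<partial>M)"
    using wiener_integral_diff_lower_bound[OF BM _ _ Y(1) Z(1)] st by simp
  also have "\<dots> = ennreal (4 * (\<integral>\<omega>. (Y \<omega> - Z \<omega>)\<^sup>2 \<partial>M))"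
    using int by (simp add: nn_integral_eq_integral ennreal_mult)
  finally have "k * (b - a) \<le> 4 * (\<integral>\<omega>. (Y \<omega> - Z \<omega>)\<^sup>2 \<partial>M)"
    by (subst (asm) ennreal_le_iff) auto
  then show ?thesis
    unfolding X_eq[symmetric] by (simp add: mult.assoc)
qed

lemma powr_not_dominated_near_0:
  fixes p q k K \<delta> :: real
  assumes "p < q" "k > 0" "\<delta> > 0"
  shows "\<exists>h. 0 < h \<and> h \<le> \<delta> \<and> K * h powr q < k * h powr p"
proof -
  have "((\<lambda>h. K * h powr (q - p)) \<longlongrightarrow> K * 0 powr (q - p)) (at_right 0)"
    using assms by (intro tendsto_intros tendsto_powr'[OF tendsto_ident_at tendsto_const])
      (auto simp: eventually_at_filter)
  then have "eventually (\<lambda>h. K * h powr (q - p) < k) (at_right 0)"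
    using assms by (intro order_tendstoD(2)) auto
  moreover have "eventually (\<lambda>h. 0 < h \<and> h \<le> \<delta>) (at_right 0)"
    using eventually_at_right_real[OF assms(3)] by (auto elim!: eventually_mono)
  ultimately have "eventually (\<lambda>h. 0 < h \<and> h \<le> \<delta> \<and> K * h powr (q - p) < k) (at_right 0)"
    by eventually_elim auto
  then obtain h where h: "0 < h" "h \<le> \<delta>" "K * h powr (q - p) < k"
    by (auto dest!: eventually_happens)
  have "K * h powr q = K * h powr (q - p) * h powr p"
    by (simp add: powr_add[symmetric])
  also have "\<dots> < k * h powr p"
    using h by (intro mult_strict_right_mono) auto
  finally show ?thesis using h by auto
qed

lemma hadamard_fbm_increment_lower_bound_near_endpoint:
  assumes "standard_brownian_motion M B" "hadamard_fbm M B \<alpha> X" "0 < \<alpha>" "\<alpha> < 1"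
    and h: "0 < h" "h \<le> T / 2"
  shows "(2 / T) powr (\<alpha> - 1) * h powr \<alpha> \<le> 4 * Gamma \<alpha> * (\<integral>\<omega>. \<bar>X T \<omega> - X (T - h) \<omega>\<bar>\<^sup>2 \<partial>M)"
proof -
  have T: "T > 0" using h by simp
  have "(2 * h / T) powr (\<alpha> - 1) * (T - (T - h)) \<le> 4 * Gamma \<alpha> * (\<integral>\<omega>. \<bar>X T \<omega> - X (T - h) \<omega>\<bar>\<^sup>2 \<partial>M)"
  proof (rule hadamard_fbm_increment_lower_bound[OF assms(1,2,3)])
    fix u assume u: "T - h < u" "u < T"
    then have u2: "T / 2 < u" using h by simp
    have "ln (T / u) \<le> T / u - 1"
      using u u2 T by (intro ln_le_minus_one) simp
    also have "\<dots> = (T - u) / u" using u2 T by (simp add: field_simps)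
    also have "\<dots> \<le> h / (T / 2)"
      using u u2 T h by (intro frac_le) auto
    finally have "ln (T / u) \<le> 2 * h / T" by (simp add: mult.commute)
    moreover have "ln (T / u) > 0" using u u2 T by (intro ln_gt_zero) simp
    ultimately show "(2 * h / T) powr (\<alpha> - 1) \<le> ln (T / u) powr (\<alpha> - 1)"
      using assms(4) by (intro powr_mono2') auto
  qed (use h in auto)
  moreover have "(2 * h / T) powr (\<alpha> - 1) * h = (2 / T) powr (\<alpha> - 1) * h powr \<alpha>"
    using h T powr_mult[of "2 / T" h "\<alpha> - 1"] by (simp add: powr_diff)
  ultimately show ?thesis by simp
qed

lemma hadamard_fbm_second_moment_lower_bound:
  assumes "standard_brownian_motion M B" "hadamard_fbm M B \<alpha> X" "1 < \<alpha>" "0 < t"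
  shows "exp (- 1) * t \<le> 4 * Gamma \<alpha> * (\<integral>\<omega>. \<bar>X t \<omega> - X 0 \<omega>\<bar>\<^sup>2 \<partial>M)"
proof -
  have "1 * (exp (- 1) * t - 0) \<le> 4 * Gamma \<alpha> * (\<integral>\<omega>. \<bar>X t \<omega> - X 0 \<omega>\<bar>\<^sup>2 \<partial>M)"
  proof (rule hadamard_fbm_increment_lower_bound[OF assms(1,2)])
    fix u assume u: "0 < u" "u < exp (- 1) * t"
    then have "exp 1 \<le> t / u"
      by (simp add: exp_minus field_simps)
    then have "1 \<le> ln (t / u)"
      using u assms by (subst ln_ge_iff) auto
    then show "1 \<le> ln (t / u) powr (\<alpha> - 1)"
      using assms by (intro ge_one_powr_ge_zero) auto
  qed (use assms in auto)
  then show ?thesis by simp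
qed

theorem theorem3p2:
  fixes M :: "'a measure" and B X :: "real \<Rightarrow> 'a \<Rightarrow> real" and \<alpha> T :: real
  assumes "standard_brownian_motion M B"
    and "\<alpha> > 0"
    and "hadamard_fbm M B \<alpha> X"
    and "T > 0"
  shows "(\<alpha> \<in> {0<..<1} \<longrightarrow>
           (\<forall>\<beta> > \<alpha>. \<not> (\<exists>C > 0. \<forall>s t. 0 \<le> s \<and> s \<le> t \<and> t \<le> T \<longrightarrow>
              (\<integral>\<omega>. \<bar>X t \<omega> - X s \<omega>\<bar>\<^sup>2 \<partial>M) \<le> C * (t - s) powr \<beta>)))
       \<and> (\<alpha> \<in> {1<..<2} \<longrightarrow>
           (\<forall>\<beta> > 1. \<not> (\<exists>C > 0. \<forall>s t. 0 \<le> s \<and> s \<le> t \<and> t \<le> T \<longrightarrow>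
              (\<integral>\<omega>. \<bar>X t \<omega> - X s \<omega>\<bar>\<^sup>2 \<partial>M) \<le> C * (t - s) powr \<beta>)))"
proof (intro conjI impI allI notI; elim exE conjE)
  fix \<beta> C
  assume \<alpha>: "\<alpha> \<in> {0<..<1}" and \<beta>: "\<beta> > \<alpha>"
    and C: "\<forall>s t. 0 \<le> s \<and> s \<le> t \<and> t \<le> T \<longrightarrow> (\<integral>\<omega>. \<bar>X t \<omega> - X s \<omega>\<bar>\<^sup>2 \<partial>M) \<le> C * (t - s) powr \<beta>"
  obtain h where h: "0 < h" "h \<le> T / 2"
    "4 * Gamma \<alpha> * C * h powr \<beta> < (2 / T) powr (\<alpha> - 1) * h powr \<alpha>"
    using powr_not_dominated_near_0[of \<alpha> \<beta> "(2 / T) powr (\<alpha> - 1)" "T / 2" "4 * Gamma \<alpha> * C"] \<beta> assms(4) by auto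
  have "(2 / T) powr (\<alpha> - 1) * h powr \<alpha> \<le> 4 * Gamma \<alpha> * (\<integral>\<omega>. \<bar>X T \<omega> - X (T - h) \<omega>\<bar>\<^sup>2 \<partial>M)"
    using \<alpha> h by (intro hadamard_fbm_increment_lower_bound_near_endpoint[OF assms(1,3)]) auto
  also have "\<dots> \<le> 4 * Gamma \<alpha> * (C * h powr \<beta>)"
    using C[rule_format, of "T - h" T] h Gamma_real_pos[OF assms(2)] by (intro mult_left_mono) auto
  finally show False using h(3) by simp
next
  fix \<beta> C
  assume \<alpha>: "\<alpha> \<in> {1<..<2}" and \<beta>: "\<beta> > 1"
    and C: "\<forall>s t. 0 \<le> s \<and> s \<le> t \<and> t \<le> T \<longrightarrow> (\<integral>\<omega>. \<bar>X t \<omega> - X s \<omega>\<bar>\<^sup>2 \<partial>M) \<le> C * (t - s) powr \<beta>"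
  obtain h where h: "0 < h" "h \<le> T"
    "4 * Gamma \<alpha> * C * h powr \<beta> < exp (- 1) * h powr 1"
    using powr_not_dominated_near_0[of 1 \<beta> "exp (- 1)" T "4 * Gamma \<alpha> * C"] \<beta> assms(4) by auto
  have "exp (- 1) * h \<le> 4 * Gamma \<alpha> * (\<integral>\<omega>. \<bar>X h \<omega> - X 0 \<omega>\<bar>\<^sup>2 \<partial>M)"
    using \<alpha> h by (intro hadamard_fbm_second_moment_lower_bound[OF assms(1,3)]) auto
  also have "\<dots> \<le> 4 * Gamma \<alpha> * (C * h powr \<beta>)"
    using C[rule_format, of 0 h] h Gamma_real_pos[OF assms(2)] by (intro mult_left_mono) auto
  finally show False using h by simp
qed

end
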